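(* Let $U\in\mathbb{R}^{n\times n}$ be nonsingular with singular values $\sigma_1\ge\cdots\ge\sigma_n>0$ and condition number $\kappa=\sigma_1/\sigma_n$. Then $$2e^{-n/2}\,\Phi(U)\ge\kappa.$$ Moreover this inequality is tight within a factor of $2$, i.e., there exists a nonsingular $\tilde U\in\mathbb{R}^{n\times n}$ with condition number $\kappa$ such that $$2e^{-n/2}\,\Phi(\tilde U)\le 2\kappa.$$
   Context: For a nonsingular matrix $U\in\mathbb{R}^{n\times n}$ with singular values $\sigma_1\ge\cdots\ge\sigma_n>0$, the function $\Phi$ is defined by $$\Phi(U)=\frac{\exp\left(\|U\|_F^2/2\right)}{\det(U^TU)^{1/2}}=\frac{\exp\left(\sum_{i=1}^n\sigma_i^2/2\right)}{\prod_{i=1}^n\sigma_i},$$ where $\|\cdot\|_F$ is the Frobenius norm. The condition number of a nonsingular matrix is the ratio of its largest to its smallest singular value. *)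

theory Defs
  imports Complex_Main "HOL-Library.Multiset" "Jordan_Normal_Form.Char_Poly"
begin

text \<open>
  The singular values of a square real matrix \<open>A\<close>, in non-increasing order: the square roots of
  the eigenvalues of \<open>A\<^sup>T A\<close>, each repeated according to its algebraic multiplicity (\<open>proots\<close>
  is the multiset of roots of a polynomial). No eigenvalue is lost by working over the reals,
  since \<open>A\<^sup>T A\<close> is symmetric positive semidefinite. Thus \<open>\<sigma>\<^sub>i\<close> is \<open>singular_values A ! (i - 1)\<close>.
\<close>

definition singular_values :: "real mat \<Rightarrow> real list" where
  "singular_values A =
     rev (sorted_list_of_multiset (image_mset sqrt (proots (char_poly (transpose_mat A * A)))))"

text \<open>The list is non-increasing, so this is the largest over the smallest singular value.\<close>

definition condition_number :: "real mat \<Rightarrow> real" where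
  "condition_number A = hd (singular_values A) / last (singular_values A)"

definition frobenius_norm :: "real mat \<Rightarrow> real" where
  "frobenius_norm A = sqrt (\<Sum>i<dim_row A. \<Sum>j<dim_col A. (A $$ (i, j))\<^sup>2)"

definition Phi :: "real mat \<Rightarrow> real" where
  "Phi A = exp ((frobenius_norm A)\<^sup>2 / 2) / sqrt (det (transpose_mat A * A))"

end

theory Submission
  imports Defs "Jordan_Normal_Form.Schur_Decomposition"
begin

text \<open>
  The characteristic polynomial of \<open>U\<^sup>T U\<close> splits over the reals with nonnegative roots: if
  \<open>v\<close> is a complex eigenvector for \<open>k\<close>, then \<open>k \<parallel>v\<parallel>\<^sup>2 = \<parallel>U v\<parallel>\<^sup>2\<close>. Hence the squared
  singular values sum to \<open>\<parallel>U\<parallel>\<^sub>F\<^sup>2\<close> and multiply to \<open>det (U\<^sup>T U)\<close>, so \<open>e\<^sup>-\<^sup>n\<^sup>/\<^sup>2 \<Phi>(U)\<close> is the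
  product of \<open>g(\<sigma>\<^sub>i)\<close> for \<open>g(x) = exp ((x\<^sup>2 - 1) / 2) / x\<close>. All factors are at least \<open>1\<close>,
  and \<open>2 g(\<sigma>\<^sub>1) g(\<sigma>\<^sub>n) \<ge> \<sigma>\<^sub>1 / \<sigma>\<^sub>n\<close> because \<open>exp (\<sigma>\<^sub>1\<^sup>2 / 2 - 1) \<ge> \<sigma>\<^sub>1\<^sup>2 / 2\<close>. A diagonal matrix
  with \<open>\<sigma>\<^sub>1\<^sup>2 + \<sigma>\<^sub>n\<^sup>2 = 2\<close> and all other singular values \<open>1\<close> gives the value
  \<open>\<kappa> + 1 / \<kappa> \<le> 2 \<kappa>\<close>.
\<close>

section \<open>Trace and determinant in terms of the eigenvalues\<close>

lemma trace_mult_comm: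
  fixes A B :: "'a :: comm_semiring_0 mat"
  assumes "A \<in> carrier_mat n m" "B \<in> carrier_mat m n"
  shows "sum_list (diag_mat (A * B)) = sum_list (diag_mat (B * A))"
proof -
  have "sum_list (diag_mat (A * B)) = (\<Sum>i<n. \<Sum>j<m. A $$ (i,j) * B $$ (j,i))"
    using assms by (auto simp: diag_mat_def interv_sum_list_conv_sum_set_nat scalar_prod_def
        atLeast0LessThan intro!: sum.cong)
  also have "\<dots> = (\<Sum>j<m. \<Sum>i<n. B $$ (j,i) * A $$ (i,j))"
    by (subst sum.swap) (simp add: mult.commute)
  also have "\<dots> = sum_list (diag_mat (B * A))"
    using assms by (auto simp: diag_mat_def interv_sum_list_conv_sum_set_nat scalar_prod_def
        atLeast0LessThan intro!: sum.cong)
  finally show ?thesis .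
qed

text \<open>The Schur decomposition makes \<open>A\<close> similar to an upper triangular matrix
  with diagonal \<open>es\<close>; trace and determinant are similarity invariants.\<close>

lemma trace_det_char_poly_factorized:
  fixes A :: "'a :: conjugatable_ordered_field mat"
  assumes A: "A \<in> carrier_mat n n"
    and cp: "char_poly A = (\<Prod>e\<leftarrow>es. [:- e, 1:])"
  shows "sum_list (diag_mat A) = sum_list es" "det A = prod_list es"
proof -
  obtain B P Q where "schur_decomposition A es = (B, P, Q)"
    by (cases "schur_decomposition A es") auto
  from schur_decomposition[OF A cp this]
  have sim: "similar_mat_wit A B P Q" and ut: "upper_triangular B" and d: "diag_mat B = es"
    by auto
  note w = similar_mat_witD2[OF A sim]
  have "sum_list (diag_mat (P * B * Q)) = sum_list (diag_mat (Q * (P * B)))"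
    using w by (intro trace_mult_comm[of _ n n]) auto
  also have "Q * (P * B) = (Q * P) * B"
    using w by (intro assoc_mult_mat[symmetric]) auto
  also have "\<dots> = B" using w by simp
  finally show "sum_list (diag_mat A) = sum_list es" using w d by simp
  have "similar_mat A B" using sim by (auto simp: similar_mat_def)
  then have "det A = det B" by (rule det_similar)
  then show "det A = prod_list es" using det_upper_triangular[OF ut] w d by auto
qed

section \<open>The spectrum of the Gram matrix\<close>

lemma of_real_poly_linear_factors:
  "map_poly complex_of_real (\<Prod>e\<leftarrow>es. [:- e, 1:]) = (\<Prod>e\<leftarrow>es. [:- complex_of_real e, 1:])"
proof -
  interpret h: map_poly_comm_ring_hom complex_of_real ..
  show ?thesis by (simp add: h.hom_prod_list o_def)
qed

lemma complex_eigenvalue_gram_mat: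
  fixes U :: "real mat"
  assumes U: "U \<in> carrier_mat m n"
    and ev: "eigenvalue (map_mat complex_of_real (transpose_mat U * U)) k"
  shows "\<exists>e \<ge> 0. k = complex_of_real e"
proof -
  define C where "C = map_mat complex_of_real U"
  have C: "C \<in> carrier_mat m n" using U by (simp add: C_def)
  have G: "map_mat complex_of_real (transpose_mat U * U) = transpose_mat C * C"
    using U by (simp add: C_def of_real_hom.mat_hom_mult[of _ n m _ n] map_mat_transpose)
  from ev obtain v where v: "v \<in> carrier_vec n" "v \<noteq> 0\<^sub>v n"
    and evv: "(transpose_mat C * C) *\<^sub>v v = k \<cdot>\<^sub>v v"
    using C unfolding G eigenvalue_def eigenvector_def by auto
  define w where "w = C *\<^sub>v v"
  have w: "w \<in> carrier_vec m" using C v by (simp add: w_def)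
  \<comment> \<open>The entries of \<open>C\<close> are real, so \<open>C\<close> commutes with
    conjugation. This lets the plain transpose act as the adjoint below.\<close>
  have conjw: "conjugate w = C *\<^sub>v conjugate v"
    using C v U by (auto simp: w_def C_def scalar_prod_def intro!: eq_vecI)
  have "k * (v \<bullet>c v) = (transpose_mat C *\<^sub>v w) \<bullet> conjugate v"
    using evv C v by (simp add: w_def assoc_mult_mat_vec[of _ n m _ n])
  also have "\<dots> = w \<bullet> (C *\<^sub>v conjugate v)"
    using C v w by (simp add: transpose_vec_mult_scalar[of _ m n])
  finally have eq: "k * (v \<bullet>c v) = w \<bullet>c w" by (simp add: conjw)
  have pos: "v \<bullet>c v > 0" using v by simp
  have "w \<bullet>c w \<ge> 0" by (rule conjugate_square_ge_0_vec)
  \<comment> \<open>Comparison with 0 in the complex order forces the imaginary part to vanish, so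
    both products are real.\<close>
  with pos have "w \<bullet>c w = of_real (Re (w \<bullet>c w))" "v \<bullet>c v = of_real (Re (v \<bullet>c v))"
    "Re (w \<bullet>c w) \<ge> 0" "Re (v \<bullet>c v) > 0"
    by (auto simp: less_eq_complex_def less_complex_def complex_eq_iff)
  then have "k = of_real (Re (w \<bullet>c w) / Re (v \<bullet>c v))" "Re (w \<bullet>c w) / Re (v \<bullet>c v) \<ge> 0"
    using eq pos by (auto simp: field_simps)
  then show ?thesis by blast
qed

text \<open>The polynomial splits over the complex numbers with real nonnegative roots; injectivity
  of the coefficient embedding pulls the factorization back to the reals.\<close>

lemma char_poly_gram_mat_factorized:
  fixes U :: "real mat"
  assumes U: "U \<in> carrier_mat m n"
  obtains es where "char_poly (transpose_mat U * U) = (\<Prod>e\<leftarrow>es. [:- e, 1:])"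
    "length es = n" "\<And>e. e \<in> set es \<Longrightarrow> e \<ge> 0"
proof -
  interpret h: map_poly_inj_comm_ring_hom complex_of_real ..
  let ?G = "transpose_mat U * U"
  let ?C = "map_mat complex_of_real ?G"
  have G: "?G \<in> carrier_mat n n" and C: "?C \<in> carrier_mat n n" using U by auto
  from char_poly_factorized[OF C] obtain ks
    where ks: "char_poly ?C = (\<Prod>k\<leftarrow>ks. [:- k, 1:])" "length ks = n" by auto
  have real: "\<exists>e \<ge> 0. k = complex_of_real e" if "k \<in> set ks" for k
  proof (rule complex_eigenvalue_gram_mat[OF U])
    show "eigenvalue ?C k"
      unfolding eigenvalue_root_char_poly[OF C] ks(1) using that
      by (auto simp: poly_prod_list prod_list_zero_iff)
  qed
  define es where "es = map Re ks"
  have es: "map complex_of_real es = ks"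
    unfolding es_def map_map by (rule map_idI) (use real in force)
  have "map_poly complex_of_real (char_poly ?G) = char_poly ?C"
    by (rule of_real_hom.char_poly_hom[OF G, symmetric])
  also have "\<dots> = map_poly complex_of_real (\<Prod>e\<leftarrow>es. [:- e, 1:])"
    unfolding of_real_poly_linear_factors ks(1) es[symmetric] by (simp add: o_def)
  finally have "char_poly ?G = (\<Prod>e\<leftarrow>es. [:- e, 1:])" by simp
  moreover have "length es = n" using ks by (simp add: es_def)
  moreover have "e \<ge> 0" if "e \<in> set es" for e using that real by (force simp: es_def)
  ultimately show ?thesis using that by blast
qed

section \<open>Singular values as a sorted list\<close>

lemma proots_linear_factors:
  "proots (\<Prod>e\<leftarrow>es. [:- e, 1:]) = mset (es :: 'a :: idom list)"
proof (induction es)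
  case (Cons a es)
  have "(\<Prod>e\<leftarrow>es. [:- e, 1:]) \<noteq> 0" by (auto simp: prod_list_zero_iff)
  then have "proots ([:- a, 1:] * (\<Prod>e\<leftarrow>es. [:- e, 1:])) = add_mset a (mset es)"
    by (subst proots_mult) (simp_all add: Cons.IH)
  then show ?case by simp
qed simp

lemma singular_values_eq:
  assumes "char_poly (transpose_mat A * A) = (\<Prod>e\<leftarrow>es. [:- e, 1:])"
  shows "singular_values A = rev (sort (map sqrt es))"
  unfolding singular_values_def assms proots_linear_factors
  by (metis mset_map sorted_list_of_multiset_mset)

lemma frobenius_norm_squared:
  "(frobenius_norm A)\<^sup>2 = sum_list (diag_mat (transpose_mat A * A))"
proof -
  have "sum_list (diag_mat (transpose_mat A * A)) = (\<Sum>j<dim_col A. \<Sum>i<dim_row A. (A $$ (i, j))\<^sup>2)"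
    by (auto simp: diag_mat_def interv_sum_list_conv_sum_set_nat scalar_prod_def
        atLeast0LessThan power2_eq_square intro!: sum.cong)
  also have "\<dots> = (frobenius_norm A)\<^sup>2"
    unfolding frobenius_norm_def by (subst sum.swap) (simp add: sum_nonneg)
  finally show ?thesis by simp
qed

lemma singular_values_properties:
  assumes U: "U \<in> carrier_mat m n"
  shows "length (singular_values U) = n"
    and "sorted (rev (singular_values U))"
    and "\<And>x. x \<in> set (singular_values U) \<Longrightarrow> x \<ge> 0"
    and "(\<Sum>x\<leftarrow>singular_values U. x\<^sup>2) = (frobenius_norm U)\<^sup>2"
    and "prod_list (singular_values U) = sqrt (det (transpose_mat U * U))"
proof -
  obtain es where es: "char_poly (transpose_mat U * U) = (\<Prod>e\<leftarrow>es. [:- e, 1:])"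
    "length es = n" "\<And>e. e \<in> set es \<Longrightarrow> e \<ge> 0"
    using char_poly_gram_mat_factorized[OF U] by blast
  have G: "transpose_mat U * U \<in> carrier_mat n n" using U by auto
  note sv = singular_values_eq[OF es(1)]
  \<comment> \<open>Sorting and reversing only permute, so sums and products can be computed from
    \<open>map sqrt es\<close>.\<close>
  have mset_sv: "mset (singular_values U) = mset (map sqrt es)" unfolding sv by simp
  show "length (singular_values U) = n" "sorted (rev (singular_values U))"
    "\<And>x. x \<in> set (singular_values U) \<Longrightarrow> x \<ge> 0"
    unfolding sv using es by auto
  have "(\<Sum>x\<leftarrow>singular_values U. x\<^sup>2) = (\<Sum>x\<leftarrow>map sqrt es. x\<^sup>2)"
    using mset_sv by (metis mset_map sum_mset_sum_list)
  also have "\<dots> = sum_list es" using es(3) by (simp add: o_def cong: map_cong)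
  finally show "(\<Sum>x\<leftarrow>singular_values U. x\<^sup>2) = (frobenius_norm U)\<^sup>2"
    by (simp add: frobenius_norm_squared trace_det_char_poly_factorized(1)[OF G es(1)])
  have "prod_list (map sqrt es) = sqrt (prod_list es)"
    by (induction es) (auto simp: real_sqrt_mult)
  with mset_sv show "prod_list (singular_values U) = sqrt (det (transpose_mat U * U))"
    by (metis prod_mset_prod_list trace_det_char_poly_factorized(2)[OF G es(1)])
qed

section \<open>Nonsingularity and positive singular values\<close>

lemma invertible_mat_iff_det:
  fixes A :: "'a :: field mat"
  assumes A: "A \<in> carrier_mat n n"
  shows "invertible_mat A \<longleftrightarrow> det A \<noteq> 0"
proof
  assume "invertible_mat A"
  then obtain B where AB: "A * B = 1\<^sub>m n" and BA: "B * A = 1\<^sub>m (dim_row B)"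
    using A by (auto simp: invertible_mat_def inverts_mat_def)
  \<comment> \<open>The shape of \<open>B\<close> is recovered by comparing the column counts in
    both identities.\<close>
  have "B \<in> carrier_mat n n"
    using A arg_cong[OF AB, of dim_col] arg_cong[OF BA, of dim_col] by auto
  then have "det A * det B = 1" using A AB by (simp flip: det_mult[of _ n])
  then show "det A \<noteq> 0" by auto
next
  assume "det A \<noteq> 0"
  from det_non_zero_imp_unit[OF A this, of "()"] obtain B
    where "B \<in> carrier_mat n n" "B * A = 1\<^sub>m n" "A * B = 1\<^sub>m n"
    by (auto simp: Units_def ring_mat_def)
  then show "invertible_mat A"
    using A by (auto simp: invertible_mat_def inverts_mat_def square_mat.simps)
qed

text \<open>The product of these nonnegative numbers is the square root of \<open>det U\<close>
  squared, hence nonzero.\<close>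

lemma singular_values_pos:
  assumes U: "U \<in> carrier_mat n n" and inv: "invertible_mat U"
    and x: "x \<in> set (singular_values U)"
  shows "x > 0"
proof -
  have "det U \<noteq> 0" using invertible_mat_iff_det[OF U] inv by simp
  then have "det (transpose_mat U * U) \<noteq> 0"
    using U by (simp add: det_mult[of _ n] det_transpose[of _ n])
  then have "prod_list (singular_values U) \<noteq> 0"
    using singular_values_properties(5)[OF U] by simp
  then have "x \<noteq> 0" using x by (auto simp: prod_list_zero_iff)
  with singular_values_properties(3)[OF U x] show ?thesis by simp
qed

section \<open>The lower bound for \<open>Phi\<close>\<close>

text \<open>The prefactor contributes one \<open>exp (-1/2)\<close> per singular value, which
  normalizes each factor to equal 1 at \<open>x = 1\<close>.\<close>

lemma exp_Phi_eq_prod: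
  assumes U: "U \<in> carrier_mat m n"
  shows "exp (- real n / 2) * Phi U = (\<Prod>x\<leftarrow>singular_values U. exp ((x\<^sup>2 - 1) / 2) / x)"
proof -
  have "(\<Prod>x\<leftarrow>xs. exp ((x\<^sup>2 - 1) / 2) / x)
      = exp (- real (length xs) / 2) * (exp ((\<Sum>x\<leftarrow>xs. x\<^sup>2) / 2) / prod_list xs)" for xs :: "real list"
    by (induction xs) (auto simp: field_simps simp flip: exp_add)
  then show ?thesis
    unfolding Phi_def using singular_values_properties[OF U] by simp
qed

lemma exp_half_square_ge:
  fixes x :: real
  assumes "x > 0"
  shows "exp ((x\<^sup>2 - 1) / 2) / x \<ge> 1"
proof -
  have "x \<le> exp (x - 1)" using exp_ge_add_one_self[of "x - 1"] by simp
  \<comment> \<open>The difference of the two sides is half the square of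
    \<open>x - 1\<close>.\<close>
  also have "x - 1 \<le> (x\<^sup>2 - 1) / 2" 
    using zero_le_power2[of "x - 1"] by (simp add: power2_eq_square field_simps)
  finally show ?thesis using assms by simp
qed

lemma prod_list_ge_1:
  fixes f :: "'a \<Rightarrow> 'b :: linordered_semidom"
  assumes "\<And>x. x \<in> set xs \<Longrightarrow> f x \<ge> 1"
  shows "prod_list (map f xs) \<ge> 1"
  using assms
proof (induction xs)
  case (Cons x xs)
  then have "1 \<le> f x" "1 \<le> prod_list (map f xs)" by auto
  then have "1 * 1 \<le> f x * prod_list (map f xs)"
    by (intro mult_mono) (auto intro: order_trans[OF zero_le_one])
  then show ?case by simp
qed simp

text \<open>Multiplying by \<open>x * y\<close> leaves only the square of \<open>x\<close> on the
  left. The tangent line of \<open>exp\<close> at 0 bounds it, and the contribution of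
  \<open>y\<close> to the exponent is nonnegative.\<close>

lemma extreme_pair_bound:
  fixes x y :: real
  assumes "x > 0" "y > 0"
  shows "x / y \<le> 2 * (exp ((x\<^sup>2 - 1) / 2) / x) * (exp ((y\<^sup>2 - 1) / 2) / y)"
proof -
  have "x\<^sup>2 / 2 \<le> exp (x\<^sup>2 / 2 - 1)" using exp_ge_add_one_self[of "x\<^sup>2 / 2 - 1"] by simp
  also have "\<dots> \<le> exp ((x\<^sup>2 - 1) / 2 + (y\<^sup>2 - 1) / 2)" by (simp add: field_simps)
  finally have "x\<^sup>2 \<le> 2 * (exp ((x\<^sup>2 - 1) / 2) * exp ((y\<^sup>2 - 1) / 2))"
    by (simp add: exp_add)
  then show ?thesis using assms by (simp add: field_simps power2_eq_square)
qed

text \<open>Separates the case where the largest and smallest singular values are the same list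
  entry, so that its factor is not counted twice.\<close>

lemma list_singleton_or_ends:
  assumes "xs \<noteq> []"
  obtains x where "xs = [x]" | x ys y where "xs = x # ys @ [y]"
  using assms by (metis list.exhaust rev_exhaust)

lemma condition_number_le:
  assumes n: "n \<ge> 1" and U: "U \<in> carrier_mat n n" and inv: "invertible_mat U"
  shows "condition_number U \<le> 2 * exp (- real n / 2) * Phi U"
proof -
  note pos = singular_values_pos[OF U inv]
  define g where "g x = exp ((x\<^sup>2 - 1) / 2) / x" for x :: real
  have g: "g x \<ge> 1" if "x \<in> set (singular_values U)" for x
    unfolding g_def using exp_half_square_ge pos[OF that] .
  have Phi: "2 * exp (- real n / 2) * Phi U = 2 * (\<Prod>x\<leftarrow>singular_values U. g x)"
    using exp_Phi_eq_prod[OF U] by (simp add: g_def)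
  have "singular_values U \<noteq> []" using singular_values_properties(1)[OF U] n by auto
  then show ?thesis
  proof (cases rule: list_singleton_or_ends)
    \<comment> \<open>Here the condition number is 1, while twice the single factor is at least
      2.\<close>
    case (1 x)
    then show ?thesis using pos[of x] g[of x] unfolding Phi by (simp add: condition_number_def)
  next
    case (2 x ys y)
    then have xy: "x > 0" "y > 0" using pos by auto
    have "condition_number U = x / y" using 2 by (simp add: condition_number_def)
    also have "\<dots> \<le> 2 * g x * g y"
      unfolding g_def by (rule extreme_pair_bound[OF xy])
    also have "\<dots> \<le> 2 * g x * g y * (\<Prod>z\<leftarrow>ys. g z)"
    proof -
      have "(\<Prod>z\<leftarrow>ys. g z) \<ge> 1" using g 2 by (intro prod_list_ge_1) auto
      moreover have "2 * g x * g y \<ge> 0" using xy by (simp add: g_def)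
      ultimately show ?thesis by (metis mult.right_neutral mult_left_mono)
    qed
    also have "\<dots> = 2 * exp (- real n / 2) * Phi U" unfolding Phi 2 by simp
    finally show ?thesis .
  qed
qed

section \<open>Matrices with prescribed singular values\<close>

text \<open>The Gram matrix is diagonal with the squares of \<open>s\<close>. Nonnegativity lets
  \<open>sqrt\<close> undo the squaring, and the order of \<open>s\<close> is the one that
  \<open>singular_values\<close> produces.\<close>

lemma singular_values_diag:
  assumes sorted: "sorted (rev s)" and nonneg: "\<And>x. x \<in> set s \<Longrightarrow> x \<ge> 0"
  shows "singular_values (mat_diag (length s) (\<lambda>i. s ! i)) = s"
proof -
  let ?n = "length s"
  let ?V = "mat_diag ?n (\<lambda>i. s ! i)"
  have "transpose_mat ?V = ?V" by (auto simp: mat_diag_def intro!: eq_matI)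
  then have G: "transpose_mat ?V * ?V = mat_diag ?n (\<lambda>i. s ! i * s ! i)" by simp
  have "diag_mat (transpose_mat ?V * ?V) = map (\<lambda>x. x\<^sup>2) s"
    unfolding G by (auto simp: diag_mat_def mat_diag_def power2_eq_square intro!: nth_equalityI)
  moreover have "char_poly (transpose_mat ?V * ?V)
      = (\<Prod>e\<leftarrow>diag_mat (transpose_mat ?V * ?V). [:- e, 1:])"
    unfolding G by (rule char_poly_upper_triangular[of _ ?n]) (auto simp: mat_diag_def)
  ultimately have "singular_values ?V = rev (sort (map sqrt (map (\<lambda>x. x\<^sup>2) s)))"
    using singular_values_eq by metis
  also have "map sqrt (map (\<lambda>x. x\<^sup>2) s) = s"
    unfolding map_map by (rule map_idI) (use nonneg in auto)
  also have "rev (sort s) = s"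
    using sorted by (metis mset_rev properties_for_sort rev_rev_ident)
  finally show ?thesis .
qed

lemma exists_mat_with_singular_values:
  assumes "sorted (rev s)" and pos: "\<And>x. x \<in> set s \<Longrightarrow> x > 0"
  obtains V where "V \<in> carrier_mat (length s) (length s)" "invertible_mat V"
    "singular_values V = s"
proof
  let ?V = "mat_diag (length s) (\<lambda>i. s ! i)"
  show V: "?V \<in> carrier_mat (length s) (length s)" by simp
  have "det ?V = prod_list (diag_mat ?V)"
    by (rule det_upper_triangular[OF _ V]) (auto simp: mat_diag_def)
  also have "diag_mat ?V = s" by (auto simp: diag_mat_def mat_diag_def intro!: nth_equalityI)
  finally show "invertible_mat ?V"
    unfolding invertible_mat_iff_det[OF V] using pos by (auto simp: prod_list_zero_iff)
  show "singular_values ?V = s"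
    using assms by (intro singular_values_diag) (auto intro: less_imp_le)
qed

section \<open>Tightness within a factor of 2\<close>

text \<open>Needed for the witness: it puts its singular values in order and yields
  \<open>1 / \<kappa> \<le> \<kappa>\<close>.\<close>

lemma condition_number_ge_1:
  assumes n: "n \<ge> 1" and U: "U \<in> carrier_mat n n" and inv: "invertible_mat U"
  shows "condition_number U \<ge> 1"
proof -
  let ?s = "singular_values U"
  note props = singular_values_properties[OF U]
  have ne: "?s \<noteq> []" using props(1) n by auto
  then show ?thesis
  proof (cases rule: list_singleton_or_ends)
    case (1 x)
    then show ?thesis using singular_values_pos[OF U inv, of x] by (simp add: condition_number_def)
  next
    case (2 x ys y)
    then have "y > 0" "y \<le> x" 
      using singular_values_pos[OF U inv] props(2) by auto
    then show ?thesis using 2 by (simp add: condition_number_def)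
  qed
qed

text \<open>
  Given \<open>x / y = \<kappa>\<close>, the value of \<open>\<Phi>\<close> is smallest when \<open>x\<^sup>2 + y\<^sup>2 = 2\<close> and the
  other singular values are \<open>1\<close>.
\<close>

lemma exists_mat_with_condition_number:
  fixes \<kappa> :: real
  assumes "n \<ge> 2" "\<kappa> \<ge> 1"
  obtains V where "V \<in> carrier_mat n n" "invertible_mat V" "condition_number V = \<kappa>"
    "2 * exp (- real n / 2) * Phi V = \<kappa> + 1 / \<kappa>"
proof -
  \<comment> \<open>Obtained by substituting \<open>x = \<kappa> * y\<close> into the condition that
    the squares of \<open>x\<close> and \<open>y\<close> sum to 2.\<close>
  define y where "y = sqrt (2 / (1 + \<kappa>\<^sup>2))"
  define x where "x = \<kappa> * y"
  define s where "s = x # replicate (n - 2) 1 @ [y]"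
  have k2: "\<kappa>\<^sup>2 \<ge> 1" using assms by simp
  have y: "y > 0" "y\<^sup>2 = 2 / (1 + \<kappa>\<^sup>2)" using k2 by (auto simp: y_def add_pos_pos)
  have x: "x > 0" "x\<^sup>2 = 2 * \<kappa>\<^sup>2 / (1 + \<kappa>\<^sup>2)" using y assms by (auto simp: x_def power_mult_distrib)
  have xy2: "x\<^sup>2 + y\<^sup>2 = 2"
    unfolding x(2) y(2) using k2 by (simp flip: add_divide_distrib add: divide_eq_eq)
  \<comment> \<open>The ones in the middle of \<open>s\<close> must lie between \<open>y\<close> and
    \<open>x\<close> for \<open>s\<close> to be non-increasing.\<close>
  have "y\<^sup>2 \<le> 1" "x\<^sup>2 \<ge> 1" unfolding x(2) y(2) using k2 by (simp_all add: divide_simps)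
  then have "y \<le> 1" "x \<ge> 1"
    using x(1) power2_le_imp_le[of y 1] power2_le_imp_le[of 1 x] by auto
  then have "sorted (rev s)" by (auto simp: s_def sorted_append)
  moreover have "z > 0" if "z \<in> set s" for z using that x y by (auto simp: s_def)
  ultimately obtain V where V: "V \<in> carrier_mat (length s) (length s)" "invertible_mat V"
    "singular_values V = s"
    using exists_mat_with_singular_values by blast
  have len: "length s = n" using assms by (simp add: s_def)
  have Vn: "V \<in> carrier_mat n n" using V len by simp
  have "condition_number V = \<kappa>" using V(3) y by (simp add: condition_number_def s_def x_def)
  moreover have "2 * exp (- real n / 2) * Phi V = \<kappa> + 1 / \<kappa>"
  proof -
    \<comment> \<open>Each of the \<open>n - 2\<close> middle singular values contributes the factor
      1.\<close>
    have "2 * exp (- real n / 2) * Phi V = 2 * (exp ((x\<^sup>2 - 1) / 2) * exp ((y\<^sup>2 - 1) / 2)) / (x * y)"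
      using exp_Phi_eq_prod[OF Vn] unfolding V(3) by (simp add: s_def map_replicate prod_list_replicate)
    also have "exp ((x\<^sup>2 - 1) / 2) * exp ((y\<^sup>2 - 1) / 2) = 1"
      using xy2 by (simp flip: exp_add add: field_simps)
    also have "x * y = 2 * \<kappa> / (1 + \<kappa>\<^sup>2)" using y(2) by (simp add: x_def power2_eq_square mult.assoc)
    finally show ?thesis using assms by (simp add: field_simps power2_eq_square)
  qed
  ultimately show ?thesis using that Vn V by blast
qed

theorem theorem2p2:
  fixes U :: "real mat" and n :: nat and \<kappa> :: real
  assumes "n \<ge> 1"
    and "U \<in> carrier_mat n n"
    and "invertible_mat U"
    and "\<kappa> = condition_number U"
  shows "2 * exp (- real n / 2) * Phi U \<ge> \<kappa> \<and>
         (\<exists>V \<in> carrier_mat n n. invertible_mat V \<and> condition_number V = \<kappa> \<and>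
            2 * exp (- real n / 2) * Phi V \<le> 2 * \<kappa>)"
proof
  show "2 * exp (- real n / 2) * Phi U \<ge> \<kappa>"
    using condition_number_le assms by simp
  have \<kappa>: "\<kappa> \<ge> 1" using condition_number_ge_1 assms by simp
  show "\<exists>V \<in> carrier_mat n n. invertible_mat V \<and> condition_number V = \<kappa> \<and>
            2 * exp (- real n / 2) * Phi V \<le> 2 * \<kappa>"
  proof (cases "n = 1")
    \<comment> \<open>With a single singular value there is no pair to choose:
      \<open>\<kappa>\<close> is 1, and the singular value 1 gives exactly
      \<open>2 * \<kappa>\<close>.\<close>
    case True
    obtain V where V: "V \<in> carrier_mat 1 1" "invertible_mat V" "singular_values V = [1]"
      using exists_mat_with_singular_values[of "[1]"] by auto
    have "length (singular_values U) = 1"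
      using singular_values_properties(1)[OF assms(2)] True by simp
    then obtain x where x: "singular_values U = [x]" by (auto simp: length_Suc_conv)
    then have "\<kappa> = 1"
      using singular_values_pos[OF assms(2,3), of x] assms(4) by (simp add: condition_number_def)
    moreover have "condition_number V = 1" using V by (simp add: condition_number_def)
    moreover have "2 * exp (- real n / 2) * Phi V = 2"
      using exp_Phi_eq_prod[OF V(1)] V(3) True by simp
    ultimately show ?thesis using V True by auto
  next
    case False
    with assms have "n \<ge> 2" by simp
    then obtain V where V: "V \<in> carrier_mat n n" "invertible_mat V" "condition_number V = \<kappa>"
      "2 * exp (- real n / 2) * Phi V = \<kappa> + 1 / \<kappa>"
      using exists_mat_with_condition_number \<kappa> by blast
    have "1 / \<kappa> \<le> \<kappa>" using \<kappa> by (smt (verit) divide_le_eq_1)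
    with V show ?thesis by (intro bexI[of _ V]) auto
  qed
qed

end
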